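(* Let $g \geq 1$ be an integer and let $\epsilon > 0$. Then $$\lim_{X \to \infty} \frac{ \# \{ f \in \mathcal{F}(X) : \exists P = (\alpha, \beta) \in C^0_f(\mathbb{Q}),\ h(\alpha) \leq (2g - 1 - \epsilon)\log \mathrm{Ht}(f) \} }{ \# \mathcal{F}(X)} = 0.$$
   Context: For a polynomial $f(x) = x^{2g+1} + c_2 x^{2g-1} + \dots + c_{2g+1}$ with real coefficients (no $x^{2g}$ term), the height is $\mathrm{Ht}(f) = \max_{2 \le i \le 2g+1} |c_i|^{1/i}$. $\mathcal{F}(X)$ is the set of such polynomials $f(x) \in \mathbb{Z}[x]$ of nonzero discriminant with $\mathrm{Ht}(f) < X$. $C_f^0$ is the affine curve $y^2 = f(x)$ over $\mathbb{Q}$. For $\alpha \in \mathbb{Q}$, $h(\alpha)$ is the logarithmic Weil height of the point $[\alpha : 1] \in \mathbb{P}^1(\mathbb{Q})$, i.e. $h(a/b) = \log \max(|a|, |b|)$ for coprime integers $a, b$ with $b \ne 0$. *)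

theory Defs
  imports
    "HOL-Analysis.Analysis"
    "HOL-Computational_Algebra.Polynomial"
    "Subresultants.Resultant_Prelim"
begin

text \<open>
  The discriminant \<open>(-1)^(n(n-1)/2) Res(f, f') / a\<^sub>n\<close> with \<open>n = deg f\<close>; the division by the
  leading coefficient is exact.
\<close>

definition discriminant :: "'a::idom_divide poly \<Rightarrow> 'a" where
  "discriminant f =
     ((-1) ^ (degree f * (degree f - 1) div 2) * resultant f (pderiv f)) div lead_coeff f"

text \<open>
  The coefficient \<open>c\<^sub>i\<close> of \<open>x^n + c\<^sub>2 x^(n-2) + \<dots> + c\<^sub>n\<close> is the one of \<open>x^(n-i)\<close>.
  Only meaningful for \<open>degree f \<ge> 2\<close>.
\<close>

definition Ht :: "real poly \<Rightarrow> real" where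
  "Ht f = Max ((\<lambda>i. root i \<bar>coeff f (degree f - i)\<bar>) ` {2..degree f})"

definition height_family :: "nat \<Rightarrow> real \<Rightarrow> int poly set" where
  "height_family g X =
     {f. degree f = 2 * g + 1 \<and> lead_coeff f = 1 \<and> coeff f (2 * g) = 0 \<and>
         discriminant f \<noteq> 0 \<and> Ht (map_poly real_of_int f) < X}"

definition affine_curve_points :: "int poly \<Rightarrow> (rat \<times> rat) set" where
  "affine_curve_points f = {(\<alpha>, \<beta>). \<beta>\<^sup>2 = poly (map_poly rat_of_int f) \<alpha>}"

definition weil_height :: "rat \<Rightarrow> real" where
  "weil_height \<alpha> = (case quotient_of \<alpha> of (a, b) \<Rightarrow> ln (real_of_int (max \<bar>a\<bar> \<bar>b\<bar>)))"

text \<open>Since \<open>card\<close> is 0 on infinite sets, finiteness is needed for it to count here.\<close>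

lemma finite_height_family: "finite (height_family g X)"
proof -
  define n where "n = 2 * g + 1"
  define B where "B = \<lceil>Max ((\<lambda>i. \<bar>X\<bar> ^ i) ` {0..n})\<rceil> + 1"
  define S where "S = {xs. set xs \<subseteq> {-B..B} \<and> length xs = Suc n}"
  have finS: "finite S"
    unfolding S_def by (rule finite_lists_length_eq) simp
  have B_ge: "\<bar>X\<bar> ^ i \<le> of_int B" if "i \<le> n" for i
  proof -
    have "\<bar>X\<bar> ^ i \<le> Max ((\<lambda>i. \<bar>X\<bar> ^ i) ` {0..n})" using that by (intro Max_ge) auto
    also have "\<dots> \<le> of_int B" unfolding B_def by linarith
    finally show ?thesis .
  qed
  have B1: "1 \<le> B" using B_ge[of 0] by simp
  have "(\<lambda>f. map (coeff f) [0..<Suc n]) ` height_family g X \<subseteq> S"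
  proof clarify
    fix f assume f: "f \<in> height_family g X"
    then have deg: "degree f = n" and lc: "coeff f n = 1" and c: "coeff f (2 * g) = 0"
      and ht: "Ht (map_poly real_of_int f) < X"
      by (auto simp: height_family_def n_def)
    have "\<bar>coeff f j\<bar> \<le> B" if jn: "j \<le> n" for j
    proof -
      consider "j = n" | "j = 2 * g" | "j < 2 * g" using jn n_def by linarith
      then show ?thesis
      proof cases
        case 3
        define i where "i = n - j"
        have i: "i \<in> {2..n}" "n - i = j" using 3 by (auto simp: i_def n_def)
        have "root i \<bar>real_of_int (coeff f j)\<bar> \<le> Ht (map_poly real_of_int f)"
          unfolding Ht_def using i deg
          by (intro Max_ge) (auto simp: degree_map_poly coeff_map_poly intro!: image_eqI[of _ _ i])
        then have "root i \<bar>real_of_int (coeff f j)\<bar> \<le> \<bar>X\<bar>" using ht by linarith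
        then have "root i \<bar>real_of_int (coeff f j)\<bar> ^ i \<le> \<bar>X\<bar> ^ i"
          by (intro power_mono) (use i in auto)
        then have "\<bar>real_of_int (coeff f j)\<bar> \<le> \<bar>X\<bar> ^ i" using i by simp
        also have "\<dots> \<le> of_int B" using i by (intro B_ge) auto
        finally show ?thesis by linarith
      qed (use lc c B1 in auto)
    qed
    then have "coeff f j \<in> {-B..B}" if "j \<le> n" for j
      using that by (simp add: abs_le_iff minus_le_iff)
    then have "coeff f ` {0..<Suc n} \<subseteq> {-B..B}" by (intro image_subsetI) (simp add: less_Suc_eq_le)
    then show "map (coeff f) [0..<Suc n] \<in> S"
      unfolding S_def by (simp only: mem_Collect_eq set_map set_upt length_map length_upt) simp
  qed
  then have "finite ((\<lambda>f. map (coeff f) [0..<Suc n]) ` height_family g X)"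
    using finS finite_subset by blast
  moreover have "inj_on (\<lambda>f. map (coeff f) [0..<Suc n]) (height_family g X)"
  proof (rule inj_onI, rule poly_eqI)
    fix p q j
    assume p: "p \<in> height_family g X" and q: "q \<in> height_family g X"
      and eq: "map (coeff p) [0..<Suc n] = map (coeff q) [0..<Suc n]"
    show "coeff p j = coeff q j"
    proof (cases "j \<le> n")
      case True
      then have "j \<in> set [0..<Suc n]" by auto
      then show ?thesis using eq unfolding map_eq_conv by blast
    next
      case False
      then show ?thesis using p q by (auto simp: height_family_def n_def coeff_eq_0)
    qed
  qed
  ultimately show ?thesis by (rule finite_imageD)
qed

end

theory Submission
  imports Defs "Subresultants.Subresultant_Gcd" "HOL-Real_Asymp.Real_Asymp"
    "HOL-Computational_Algebra.Fundamental_Theorem_Algebra"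
begin

text \<open>
  If \<open>y\<^sup>2 = f(x)\<close> has a rational point over \<open>\<alpha>\<close>, then \<open>\<alpha> = a/d\<^sup>2\<close> in lowest terms and \<open>c\<^sup>2 = F(a, d\<^sup>2)\<close>
  for an integer \<open>c\<close> and the homogenization \<open>F\<close> of \<open>f\<close>.  Fix \<open>a\<close>, \<open>d\<close> and all coefficients but the two
  lowest, \<open>c\<^bsub>2g\<^esub>\<close> and \<open>c\<^bsub>2g+1\<^esub>\<close>.  Then \<open>c\<close> lies in a short interval and is a square root of a fixed unit
  modulo \<open>d\<^bsup>4g\<^esup>\<close>, so there are few values of \<open>c\<close>; and given \<open>c\<close>, the coefficient \<open>c\<^bsub>2g\<^esub>\<close> is fixed modulo
  \<open>d\<^sup>2\<close> and determines \<open>c\<^bsub>2g+1\<^esub>\<close>.  Since \<open>|a|, d\<^sup>2 \<le> X\<^bsup>2g-1\<^esup>\<close>, this leaves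
  \<open>O(X\<^bsup>4g+1/2\<^esup> / (d (|a| + 1)))\<close> pairs, and summing over \<open>a\<close> and \<open>d\<close> costs only a factor \<open>log\<^sup>2 X\<close>.
  Conversely at least \<open>X\<^bsup>4g+1\<^esup>\<close> pairs give a member of the family, because for fixed remaining
  coefficients the discriminant vanishes for at most \<open>2g\<close> values of \<open>c\<^bsub>2g+1\<^esub>\<close>.
\<close>

section \<open>Counting residues and square roots modulo a power\<close>

lemma gcd_power_dvd_power_gcd: "gcd (a ^ n) b dvd (gcd a b :: int) ^ n"
proof -
  have "gcd (a ^ n) b dvd a ^ n" "gcd (a ^ n) b dvd b ^ n \<or> n = 0"
    by (auto intro: dvd_trans[OF gcd_dvd2] dvd_power)
  then show ?thesis by (auto simp: gcd_exp[symmetric] simp del: gcd_exp)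
qed

text \<open>Offsets from the least element, divided by \<open>m\<close>, are distinct integers
  between 0 and \<open>\<Lambda> / m\<close>.\<close>

lemma card_spaced_le:
  fixes S :: "int set" and \<Lambda> :: real
  assumes "finite S" "m \<ge> 1" "\<Lambda> \<ge> 0"
    and cong: "\<And>x y. x \<in> S \<Longrightarrow> y \<in> S \<Longrightarrow> m dvd x - y"
    and near: "\<And>x y. x \<in> S \<Longrightarrow> y \<in> S \<Longrightarrow> \<bar>real_of_int (x - y)\<bar> \<le> \<Lambda>"
  shows "real (card S) \<le> \<Lambda> / m + 1"
proof (cases "S = {}")
  case False
  define s where "s = Min S"
  have s: "s \<in> S" "\<And>x. x \<in> S \<Longrightarrow> s \<le> x" using False \<open>finite S\<close> by (auto simp: s_def)
  have "inj_on (\<lambda>x. (x - s) div m) S"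
  proof (rule inj_onI)
    fix x y assume "x \<in> S" "y \<in> S" "(x - s) div m = (y - s) div m"
    then have "x - s = y - s" using cong s(1) by (metis dvd_div_mult_self)
    then show "x = y" by simp
  qed
  moreover have "(x - s) div m \<in> {0..\<lfloor>\<Lambda> / m\<rfloor>}" if "x \<in> S" for x
  proof -
    have "real_of_int ((x - s) div m) = (x - s) / m"
      using cong[OF that s(1)] by (simp add: real_of_int_div)
    also have "\<dots> \<le> \<Lambda> / m" using near[OF that s(1)] assms(2) by (intro divide_right_mono) auto
    finally show ?thesis using s(2)[OF that] assms(2) by (simp add: le_floor_iff pos_imp_zdiv_nonneg_iff)
  qed
  ultimately have "card S \<le> card {0..\<lfloor>\<Lambda> / m\<rfloor>}" by (intro card_inj_on_le) auto
  also have "\<dots> = nat (\<lfloor>\<Lambda> / m\<rfloor> + 1)" by simp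
  finally have "real (card S) \<le> real (nat (\<lfloor>\<Lambda> / m\<rfloor> + 1))" by simp
  also have "\<dots> = of_int (\<lfloor>\<Lambda> / m\<rfloor> + 1)" using assms by simp
  finally show ?thesis by linarith
qed (use assms in auto)

lemma card_le_mult_fibres:
  assumes "finite S" "finite Y" "f ` S \<subseteq> Y" "\<And>y. y \<in> Y \<Longrightarrow> real (card {x \<in> S. f x = y}) \<le> B"
  shows "real (card S) \<le> real (card Y) * B"
proof -
  have "real (card S) = (\<Sum>y\<in>Y. real (card {x \<in> S. f x = y}))"
    using sum.group[OF assms(1-3), of "\<lambda>_. 1 :: nat"] by (simp flip: of_nat_sum)
  also have "\<dots> \<le> (\<Sum>y\<in>Y. B)" using assms(4) by (rule sum_mono)
  finally show ?thesis by simp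
qed

text \<open>
  Relative to a fixed root \<open>c\<^sub>0\<close>, a root \<open>c\<close> splits \<open>d\<^sup>k\<close> into \<open>u = gcd (c - c\<^sub>0) (d\<^sup>k)\<close> and a
  cofactor dividing \<open>c + c\<^sub>0\<close>, with no common factor beyond 2.  Hence \<open>u\<close> determines \<open>c\<close> modulo
  \<open>d\<^sup>k / 2\<close>, and \<open>u\<close> itself is recovered from \<open>gcd u d\<close> up to a power of 2.
\<close>

lemma card_square_roots_mod_le:
  fixes d A :: int and S :: "int set" and \<Lambda> :: real
  assumes "d \<ge> 1" "k \<ge> 1" "coprime A d" "finite S" "\<Lambda> \<ge> 0"
    and root: "\<And>c. c \<in> S \<Longrightarrow> d ^ k dvd c\<^sup>2 - A"
    and near: "\<And>x y. x \<in> S \<Longrightarrow> y \<in> S \<Longrightarrow> \<bar>real_of_int (x - y)\<bar> \<le> \<Lambda>"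
  shows "real (card S) \<le> k * d * (2 * \<Lambda> / d ^ k + 1)"
proof (cases "S = {}")
  case False
  then obtain c0 where c0: "c0 \<in> S" by auto
  define D where "D = d ^ k"
  define u where "u c = gcd (c - c0) D" for c
  \<comment> \<open>Since \<open>gcd (u c) d ^ k = gcd (u c ^ k) (d ^ k)\<close>, the two components
    together determine \<open>u c\<close>. The second one divides a power of
    \<open>gcd (u c) (D div u c)\<close>, which itself divides 2, so it takes at most
    \<open>k\<close> values.\<close>
  define key where "key c = (gcd (u c) d, gcd (u c ^ (k - 1)) (D div u c))" for c
  have D: "D > 0" using assms by (simp add: D_def)
  have "coprime (c0\<^sup>2) D"
  proof (rule coprimeI)
    fix x assume x: "x dvd c0\<^sup>2" "x dvd D"
    have "x dvd c0\<^sup>2 - A" using x(2) root[OF c0] unfolding D_def by (rule dvd_trans)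
    with x(1) have "x dvd c0\<^sup>2 - (c0\<^sup>2 - A)" by (rule dvd_diff)
    then have "x dvd A" by simp
    moreover have "coprime A D" using assms by (simp add: D_def)
    ultimately show "is_unit x" using x(2) by (metis coprime_common_divisor)
  qed
  then have c0D: "coprime c0 D" by simp
  have u: "u c > 0" "u c * (D div u c) = D" "u c dvd c - c0" "D div u c > 0" for c
  proof -
    show "u c > 0" "u c * (D div u c) = D" "u c dvd c - c0" using D by (auto simp: u_def)
    then show "D div u c > 0" using D by (metis zero_less_mult_pos)
  qed
  have w: "D div u c dvd c + c0" if "c \<in> S" for c
  proof -
    have "D dvd (c\<^sup>2 - A) - (c0\<^sup>2 - A)" using root[OF that] root[OF c0] unfolding D_def by (rule dvd_diff)
    also have "\<dots> = (c - c0) * (c + c0)" by (simp add: power2_eq_square algebra_simps)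
    also have "c - c0 = u c * ((c - c0) div u c)" using u(3)[of c] by simp
    finally have "u c * (D div u c) dvd u c * (((c - c0) div u c) * (c + c0))"
      unfolding u(2) by (simp only: mult.assoc)
    then have *: "D div u c dvd ((c - c0) div u c) * (c + c0)"
      using u(1)[of c] by simp
    have "coprime ((c - c0) div u c) (D div u c)"
      unfolding u_def using D by (intro div_gcd_coprime) auto
    then show ?thesis using * by (simp add: coprime_commute coprime_dvd_mult_right_iff)
  qed
  have two: "gcd (u c) (D div u c) dvd 2" if "c \<in> S" for c
  proof -
    let ?g = "gcd (u c) (D div u c)"
    have "?g dvd (c + c0) - (c - c0)"
      using w[OF that] u(3)[of c] by (meson dvd_diff dvd_trans gcd_dvd1 gcd_dvd2)
    then have "?g dvd c0 * 2" by (simp add: algebra_simps)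
    moreover have "coprime ?g c0"
    proof -
      have "?g dvd D" by (metis dvd_triv_left dvd_trans gcd_dvd1 u(2))
      then show ?thesis using c0D by (metis coprime_commute coprime_divisors dvd_refl)
    qed
    ultimately show ?thesis by (simp add: coprime_dvd_mult_right_iff)
  qed
  have key_u: "fst (key c) ^ k = u c * snd (key c)" for c
  proof -
    have "fst (key c) ^ k = gcd (u c ^ k) (u c * (D div u c))"
      unfolding u(2) by (simp add: key_def D_def)
    also have "u c ^ k = u c * u c ^ (k - 1)" using assms(2) by (cases k) auto
    also have "gcd (u c * u c ^ (k - 1)) (u c * (D div u c)) = u c * snd (key c)"
      using u(1)[of c] by (simp add: key_def gcd_mult_left)
    finally show ?thesis .
  qed
  have key_mem: "key c \<in> {1..d} \<times> (\<lambda>j. 2 ^ j) ` {..<k}" if "c \<in> S" for c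
  proof -
    have "gcd (u c) d \<le> d" using assms(1) by (intro zdvd_imp_le) auto
    moreover have "gcd (u c) d \<ge> 1" using assms(1) by (simp add: int_one_le_iff_zero_less)
    moreover have "gcd (u c ^ (k - 1)) (D div u c) \<in> (\<lambda>j. 2 ^ j) ` {..<k}"
    proof -
      let ?h = "gcd (u c ^ (k - 1)) (D div u c)"
      have "prime (2 :: int)" by simp
      moreover have "?h dvd 2 ^ (k - 1)"
        using gcd_power_dvd_power_gcd dvd_power_same[OF two[OF that]] dvd_trans by blast
      ultimately obtain m where "m \<le> k - 1" "normalize ?h = normalize (2 ^ m)"
        by (rule divides_primepow_weak)
      then have "m < k" "?h = 2 ^ m" using assms(2) by auto
      then show ?thesis by auto
    qed
    ultimately show ?thesis by (simp add: key_def)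
  qed
  have fibre: "real (card {c \<in> S. key c = y}) \<le> 2 * \<Lambda> / D + 1" for y
  proof -
    \<comment> \<open>The difference \<open>c - c'\<close> is known to be a multiple only of
      \<open>D / 2\<close>, which need not be an integer; doubling the elements gives spacing
      \<open>D\<close> over length \<open>2 * \<Lambda>\<close>.\<close>
    have "card ((\<lambda>c. 2 * c) ` {c \<in> S. key c = y}) = card {c \<in> S. key c = y}"
      by (rule card_image) (auto simp: inj_on_def)
    moreover have "real (card ((\<lambda>c. 2 * c) ` {c \<in> S. key c = y})) \<le> 2 * \<Lambda> / D + 1"
    proof (rule card_spaced_le)
      fix x x' assume "x \<in> (\<lambda>c. 2 * c) ` {c \<in> S. key c = y}" "x' \<in> (\<lambda>c. 2 * c) ` {c \<in> S. key c = y}"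
      then obtain c c' where c: "c \<in> S" "c' \<in> S" "key c = key c'" "x = 2 * c" "x' = 2 * c'" by auto
      have "snd (key c) > 0" using key_mem[OF c(1)] by auto
      then have uu: "u c = u c'" using key_u[of c] key_u[of c'] c(3) by auto
      have "u c dvd (c - c0) - (c' - c0)" using u(3)[of c] u(3)[of c'] uu by (metis dvd_diff)
      then have 1: "u c dvd c - c'" by simp
      have "D div u c dvd (c + c0) - (c' + c0)" using w[OF c(1)] w[OF c(2)] uu by (metis dvd_diff)
      then have 2: "D div u c dvd c - c'" by simp
      have "lcm (u c) (D div u c) dvd c - c'" using 1 2 by simp
      then have "gcd (u c) (D div u c) * lcm (u c) (D div u c) dvd 2 * (c - c')"
        using two[OF c(1)] by (rule mult_dvd_mono[rotated])
      moreover have "gcd (u c) (D div u c) * lcm (u c) (D div u c) = D"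
        using u[of c] by (simp add: prod_gcd_lcm_int[symmetric] abs_mult[symmetric])
      ultimately have "D dvd 2 * (c - c')" by (simp only:)
      then show "D dvd x - x'" using c by (simp add: right_diff_distrib)
      show "\<bar>real_of_int (x - x')\<bar> \<le> 2 * \<Lambda>" using near[OF c(1,2)] c by (auto simp: abs_le_iff)
    qed (use assms D in auto)
    ultimately show ?thesis by simp
  qed
  let ?Y = "{1..d} \<times> (\<lambda>j. 2 ^ j :: int) ` {..<k}"
  have "real (card S) \<le> real (card ?Y) * (2 * \<Lambda> / D + 1)"
  proof (rule card_le_mult_fibres[where f = key])
    show "key ` S \<subseteq> ?Y" using key_mem by (rule image_subsetI)
  qed (use fibre assms(4) in auto)
  also have "card ?Y \<le> nat d * k"
    unfolding card_cartesian_product using card_image_le[of "{..<k}" "\<lambda>j. 2 ^ j :: int"] by simp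
  then have "real (card ?Y) * (2 * \<Lambda> / D + 1) \<le> real (nat d * k) * (2 * \<Lambda> / D + 1)"
    using assms D by (intro mult_right_mono) (simp_all only: of_nat_le_iff, auto)
  finally show ?thesis using assms(1) by (simp add: D_def mult.commute)
qed (use assms in auto)

section \<open>Vanishing discriminants\<close>

text \<open>Monicity turns the division in the discriminant into one by 1, so the resultant of
  \<open>f\<close> and \<open>pderiv f\<close> vanishes and their gcd over the integers has positive
  degree. A complex root of the gcd serves.\<close>

lemma discriminant_monic_eq_0_imp_common_root:
  fixes f :: "int poly"
  assumes "lead_coeff f = 1" "discriminant f = 0"
  obtains z :: complex where "poly (map_poly of_int f) z = 0" "poly (map_poly of_int (pderiv f)) z = 0"
proof -
  have "resultant f (pderiv f) = 0" using assms by (auto simp: discriminant_def)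
  then have deg: "degree (gcd f (pderiv f)) \<noteq> 0" by (simp add: resultant_0_gcd)
  let ?g = "map_poly complex_of_int (gcd f (pderiv f))"
  have "\<not> constant (poly ?g)" using deg by (simp add: constant_degree)
  then obtain z where z: "poly ?g z = 0" using fundamental_theorem_of_algebra by blast
  have "poly (map_poly of_int h) z = 0" if "gcd f (pderiv f) dvd h" for h
  proof -
    from that obtain e where "h = gcd f (pderiv f) * e" by (rule dvdE)
    then have "map_poly complex_of_int h = ?g * map_poly of_int e" by (simp add: of_int_poly_hom.hom_mult)
    then show ?thesis using z by simp
  qed
  then show ?thesis using that by auto
qed

text \<open>The derivative of \<open>u + x q\<close> is independent of \<open>u\<close>, so a double
  root is among its at most \<open>degree q\<close> complex zeros \<open>z\<close>, and
  \<open>z\<close> determines \<open>u = - z q(z)\<close>.\<close>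

lemma card_discriminant_eq_0_le:
  fixes q :: "int poly"
  assumes "lead_coeff q = 1" "degree q \<ge> 1"
  defines "Z \<equiv> {u. discriminant (pCons u q) = 0}"
  shows "finite Z" "card Z \<le> degree q"
proof -
  define R where "R = {z :: complex. poly (map_poly of_int (pderiv (pCons 0 q))) z = 0}"
  have q0: "q \<noteq> 0" using assms(1) by auto
  have deg: "degree (pderiv (pCons 0 q)) = degree q" using q0 by (simp add: degree_pderiv)
  then have nz: "map_poly complex_of_int (pderiv (pCons 0 q)) \<noteq> 0" using assms(2) by auto
  have R: "finite R" "card R \<le> degree q"
    unfolding R_def using poly_roots_finite[OF nz] poly_roots_degree[OF nz] deg by auto
  have sub: "complex_of_int ` Z \<subseteq> (\<lambda>z. - (z * poly (map_poly of_int q) z)) ` R"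
  proof clarify
    fix u assume "u \<in> Z"
    then have "discriminant (pCons u q) = 0" "lead_coeff (pCons u q) = 1" using assms q0 by auto
    then obtain z :: complex where z: "poly (map_poly of_int (pCons u q)) z = 0"
      "poly (map_poly of_int (pderiv (pCons u q))) z = 0"
      using discriminant_monic_eq_0_imp_common_root by blast
    have "pderiv (pCons u q) = pderiv (pCons 0 q)" by (simp add: pderiv_pCons)
    then have "z \<in> R" using z(2) by (simp add: R_def)
    moreover have "complex_of_int u = - (z * poly (map_poly of_int q) z)"
      using z(1) by (simp add: of_int_hom.map_poly_pCons_hom eq_neg_iff_add_eq_0)
    ultimately show "complex_of_int u \<in> (\<lambda>z. - (z * poly (map_poly of_int q) z)) ` R" by blast
  qed
  have inj: "inj_on complex_of_int Z" by (auto simp: inj_on_def)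
  show "finite Z" using finite_subset[OF sub] R inj by (simp add: finite_image_iff)
  have "card Z = card (complex_of_int ` Z)" using inj by (simp add: card_image)
  also have "\<dots> \<le> card ((\<lambda>z. - (z * poly (map_poly of_int q) z)) ` R)" using sub R by (intro card_mono) auto
  also have "\<dots> \<le> degree q" using card_image_le[OF R(1)] R(2) le_trans by blast
  finally show "card Z \<le> degree q" .
qed

section \<open>Homogenization and the shape of rational points\<close>

definition hom_eval :: "int poly \<Rightarrow> int \<Rightarrow> int \<Rightarrow> int" where
  "hom_eval f a b = (\<Sum>j\<le>degree f. coeff f j * a ^ j * b ^ (degree f - j))"

lemma hom_eval_eq_poly:
  fixes a b :: int
  assumes "b \<noteq> 0"
  shows "of_int (hom_eval f a b) =
    of_int b ^ degree f * poly (map_poly of_int f) (of_int a / of_int b :: 'a::field_char_0)"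
proof -
  have "(of_int b :: 'a) ^ (degree f - j) = of_int b ^ degree f / of_int b ^ j" if "j \<le> degree f" for j
    using assms that by (simp add: power_diff)
  then show ?thesis
    by (auto simp: hom_eval_def poly_altdef sum_distrib_left power_divide intro!: sum.cong)
qed

lemma hom_eval_pCons:
  assumes "q \<noteq> 0"
  shows "hom_eval (pCons u q) a b = u * b ^ Suc (degree q) + a * hom_eval q a b"
  using assms
  by (simp add: hom_eval_def sum.atMost_Suc_shift sum_distrib_left mult_ac del: sum.atMost_Suc)

lemma hom_eval_monic:
  assumes "lead_coeff f = 1"
  shows "hom_eval f a b = a ^ degree f + (\<Sum>j<degree f. coeff f j * a ^ j * b ^ (degree f - j))"
  using assms by (simp add: hom_eval_def lessThan_Suc_atMost[symmetric] add.commute)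

text \<open>Modulo \<open>b\<close> only the leading term \<open>a ^ degree f\<close>
  survives.\<close>

lemma coprime_hom_eval:
  assumes "lead_coeff f = 1" "coprime a b"
  shows "coprime (hom_eval f a b) b"
proof -
  have "b dvd (\<Sum>j<degree f. coeff f j * a ^ j * b ^ (degree f - j))"
    by (intro dvd_sum dvd_mult) (simp add: dvd_power)
  then obtain s where "hom_eval f a b = a ^ degree f + b * s"
    unfolding hom_eval_monic[OF assms(1)] by (metis dvdE)
  moreover have "coprime (a ^ degree f) b" using assms(2) by simp
  ultimately show ?thesis
    by (metis add.commute coprime_iff_gcd_eq_1 gcd_add_mult mult.commute gcd.commute)
qed

text \<open>For such large \<open>a\<close> the leading term dominates. With
  \<open>n = degree f\<close>, the term of index \<open>j\<close> is at most
  \<open>|a|^n / 2^(n-j)\<close>; as the coefficient of index \<open>n - 1\<close> is zero, the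
  lower terms add up to at most \<open>(1/4 + 1/8 + ...) |a|^n\<close>, hence to at most half the
  leading term.\<close>

lemma abs_hom_eval_ge:
  fixes X :: real
  assumes "lead_coeff f = 1" "coeff f (degree f - 1) = 0" "degree f \<ge> 1"
    and coeff: "\<And>j. j < degree f \<Longrightarrow> \<bar>real_of_int (coeff f j)\<bar> \<le> X ^ (degree f - j)"
    and "X \<ge> 0" "b \<ge> 0" "2 * X * b \<le> \<bar>real_of_int a\<bar>"
  shows "\<bar>real_of_int a\<bar> ^ degree f / 2 \<le> \<bar>real_of_int (hom_eval f a b)\<bar>"
proof -
  obtain m where m: "degree f = Suc m" using assms(3) by (cases "degree f") auto
  let ?a = "\<bar>real_of_int a\<bar>"
  let ?t = "\<lambda>j. real_of_int (coeff f j * a ^ j * b ^ (Suc m - j))"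
  \<comment> \<open>The exponent \<open>Suc m - j\<close> is written as
    \<open>2 + (m - Suc j)\<close> so that the sum reindexes to a geometric one starting at
    \<open>1/4\<close>.\<close>
  have "\<bar>?t j\<bar> \<le> ?a ^ Suc m * (1/2) ^ (2 + (m - Suc j))" if "j < m" for j
  proof -
    have "\<bar>?t j\<bar> = \<bar>real_of_int (coeff f j)\<bar> * ?a ^ j * b ^ (Suc m - j)"
      using \<open>b \<ge> 0\<close> by (simp add: abs_mult power_abs)
    also have "\<dots> \<le> X ^ (Suc m - j) * ?a ^ j * b ^ (Suc m - j)"
      using coeff[of j] that m \<open>b \<ge> 0\<close> by (intro mult_right_mono) auto
    also have "\<dots> = ?a ^ j * (X * b) ^ (Suc m - j)" by (simp add: power_mult_distrib)
    also have "\<dots> \<le> ?a ^ j * (?a / 2) ^ (Suc m - j)"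
      using assms by (intro mult_left_mono power_mono) auto
    also have "\<dots> = ?a ^ (j + (Suc m - j)) * (1/2) ^ (Suc m - j)"
      by (simp only: power_add power_divide) simp
    also have "j + (Suc m - j) = Suc m" using that by simp
    finally have *: "\<bar>?t j\<bar> \<le> ?a ^ Suc m * (1/2) ^ (Suc m - j)" .
    have "Suc m - j = 2 + (m - Suc j)" using that by simp
    then show ?thesis using * by simp
  qed
  then have "\<bar>\<Sum>j<m. ?t j\<bar> \<le> (\<Sum>j<m. ?a ^ Suc m * (1/2) ^ (2 + (m - Suc j)))"
    by (intro order_trans[OF sum_abs] sum_mono) auto
  also have "\<dots> = ?a ^ Suc m * (\<Sum>j<m. (1/2) ^ (2 + (m - Suc j)))" by (simp only: sum_distrib_left)
  also have "(\<Sum>j<m. (1/2) ^ (2 + (m - Suc j))) = (\<Sum>j<m. (1/2::real) ^ (2 + j))"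
    by (rule sum.nat_diff_reindex)
  also have "\<dots> = 1/2 - (1/2) ^ Suc m" by (induction m) (auto simp: field_simps)
  also have "?a ^ Suc m * (1/2 - (1/2) ^ Suc m) \<le> ?a ^ Suc m * (1/2)"
    by (intro mult_left_mono) auto
  finally have "\<bar>\<Sum>j<m. ?t j\<bar> \<le> ?a ^ Suc m / 2" by simp
  moreover have "real_of_int (hom_eval f a b) = real_of_int a ^ Suc m + (\<Sum>j<m. ?t j)"
    using assms(2) m by (simp add: hom_eval_monic[OF assms(1)])
  moreover have "\<bar>real_of_int a ^ Suc m\<bar> = ?a ^ Suc m" by (rule power_abs)
  ultimately show ?thesis unfolding m by linarith
qed

text \<open>With \<open>\<alpha> = a/b\<close> and \<open>\<beta> = p/q\<close> in lowest terms,
  clearing denominators gives \<open>F q^2 = b^(2g+1) p^2\<close>. As \<open>F\<close> is coprime to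
  \<open>b\<close> and \<open>p\<close> to \<open>q\<close>, this forces
  \<open>q^2 = b^(2g+1)\<close>, and the odd exponent makes \<open>b = (q / b^g)^2\<close> a
  square.\<close>

lemma rational_point_on_odd_monic:
  assumes "lead_coeff f = 1" "degree f = 2 * g + 1"
    and "(\<alpha>, \<beta>) \<in> affine_curve_points f"
  obtains a d c where "quotient_of \<alpha> = (a, d\<^sup>2)" "coprime a d" "d \<ge> 1" "c \<ge> 0"
    "c\<^sup>2 = hom_eval f a (d\<^sup>2)"
proof -
  obtain a b where ab: "quotient_of \<alpha> = (a, b)" by force
  then have \<alpha>: "\<alpha> = of_int a / of_int b" "b > 0" "coprime a b"
    using quotient_of_div quotient_of_denom_pos quotient_of_coprime by auto
  obtain p q where pq: "quotient_of \<beta> = (p, q)" by force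
  then have \<beta>: "\<beta> = of_int p / of_int q" "q > 0" "coprime p q"
    using quotient_of_div quotient_of_denom_pos quotient_of_coprime by auto
  let ?F = "hom_eval f a b" and ?n = "2 * g + 1"
  have "\<beta>\<^sup>2 = poly (map_poly rat_of_int f) \<alpha>" using assms(3) by (simp add: affine_curve_points_def)
  then have "rat_of_int ?F = of_int b ^ ?n * (of_int p / of_int q)\<^sup>2"
    using hom_eval_eq_poly[of b f a, where 'a = rat] \<alpha> \<beta> assms(2) by simp
  then have "rat_of_int (?F * q\<^sup>2) = rat_of_int (b ^ ?n * p\<^sup>2)"
    using \<beta>(2) by (simp add: power_divide)
  then have eq: "?F * q\<^sup>2 = b ^ ?n * p\<^sup>2" by (simp only: of_int_eq_iff)
  have "coprime ?F (b ^ ?n)" using coprime_hom_eval[OF assms(1) \<alpha>(3)] by simp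
  then have "b ^ ?n dvd q\<^sup>2"
    using eq by (metis coprime_commute coprime_dvd_mult_right_iff dvd_triv_left)
  moreover have "coprime (p\<^sup>2) (q\<^sup>2)" using \<beta>(3) by simp
  then have "q\<^sup>2 dvd b ^ ?n"
    using eq by (metis coprime_commute coprime_dvd_mult_left_iff dvd_triv_right)
  ultimately have q2: "q\<^sup>2 = b ^ ?n" using \<alpha>(2) by (intro zdvd_antisym_nonneg) auto
  then have F: "?F = p\<^sup>2" using eq \<alpha>(2) by simp
  have "(b ^ g)\<^sup>2 dvd q\<^sup>2" unfolding q2 by (simp add: power_mult[symmetric] mult.commute)
  then have "b ^ g dvd q" by simp
  then obtain d where d: "q = b ^ g * d" by (rule dvdE)
  have "d > 0" using d \<beta>(2) \<alpha>(2) by (metis zero_less_mult_pos zero_less_power)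
  have "(b ^ g)\<^sup>2 * d\<^sup>2 = (b ^ g)\<^sup>2 * b"
    using q2 unfolding d by (simp add: power_mult_distrib power_mult[symmetric] mult.commute)
  then have b: "b = d\<^sup>2" using \<alpha>(2) by simp
  show ?thesis
    using that[of a d "\<bar>p\<bar>"] ab F \<open>d > 0\<close> \<alpha>(3) unfolding b by simp
qed

section \<open>Height bounds on coefficients and points\<close>

lemma Ht_less_iff:
  fixes X :: real
  assumes "degree f = n" "n \<ge> 2" "X > 0"
  shows "Ht (map_poly real_of_int f) < X \<longleftrightarrow> (\<forall>j. j + 2 \<le> n \<longrightarrow> \<bar>real_of_int (coeff f j)\<bar> < X ^ (n - j))"
proof -
  have "root i \<bar>c\<bar> < X \<longleftrightarrow> \<bar>c\<bar> < X ^ i" if "i \<ge> 2" for i and c :: real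
    using that real_root_less_iff[of i "\<bar>c\<bar>" "X ^ i"] assms(3) by (simp add: real_root_power_cancel)
  then have "Ht (map_poly real_of_int f) < X \<longleftrightarrow> (\<forall>i\<in>{2..n}. \<bar>real_of_int (coeff f (n - i))\<bar> < X ^ i)"
    using assms by (auto simp: Ht_def coeff_map_poly)
  also have "\<dots> \<longleftrightarrow> (\<forall>j. j + 2 \<le> n \<longrightarrow> \<bar>real_of_int (coeff f j)\<bar> < X ^ (n - j))"
  proof (intro iffI allI impI ballI)
    fix j assume "\<forall>i\<in>{2..n}. \<bar>real_of_int (coeff f (n - i))\<bar> < X ^ i" "j + 2 \<le> n"
    then show "\<bar>real_of_int (coeff f j)\<bar> < X ^ (n - j)" by (auto dest!: bspec[of _ _ "n - j"])
  next
    fix i assume "\<forall>j. j + 2 \<le> n \<longrightarrow> \<bar>real_of_int (coeff f j)\<bar> < X ^ (n - j)" "i \<in> {2..n}"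
    then show "\<bar>real_of_int (coeff f (n - i))\<bar> < X ^ i" by (auto dest!: spec[of _ "n - i"])
  qed
  finally show ?thesis .
qed

text \<open>The maximum is attained at a root of the absolute value of an integer, so
  \<open>Ht\<close> is 0 or at least 1. In the first case the convention \<open>ln 0 = 0\<close>
  gives both bounds.\<close>

lemma ln_Ht_bounds:
  assumes "degree f \<ge> 2" "Ht (map_poly real_of_int f) < X" "X \<ge> 1"
  shows "0 \<le> ln (Ht (map_poly real_of_int f))" "ln (Ht (map_poly real_of_int f)) \<le> ln X"
proof -
  have "Ht (map_poly real_of_int f)
    \<in> (\<lambda>i. root i \<bar>coeff (map_poly real_of_int f) (degree f - i)\<bar>) ` {2..degree f}"
    unfolding Ht_def using assms(1) by (simp add: degree_map_poly)
  then obtain i where i: "i \<ge> 2" "Ht (map_poly real_of_int f) = root i \<bar>real_of_int (coeff f (degree f - i))\<bar>"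
    by (auto simp: coeff_map_poly)
  have "Ht (map_poly real_of_int f) = 0 \<or> Ht (map_poly real_of_int f) \<ge> 1"
  proof (cases "coeff f (degree f - i) = 0")
    case False
    then have "1 \<le> \<bar>real_of_int (coeff f (degree f - i))\<bar>" by linarith
    then show ?thesis using i by simp
  qed (use i in simp)
  then show "0 \<le> ln (Ht (map_poly real_of_int f))" "ln (Ht (map_poly real_of_int f)) \<le> ln X"
    using assms by auto
qed

text \<open>
  Removing the two lowest coefficients \<open>u = c\<^bsub>2g+1\<^esub>\<close> and \<open>v = c\<^bsub>2g\<^esub>\<close> from a member
  \<open>pCons u (pCons v q)\<close> of the family leaves such a \<open>q\<close>; \<open>g = 1\<close> leaves only \<open>q = x\<close>.
\<close>

definition tails :: "nat \<Rightarrow> real \<Rightarrow> int poly set" where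
  "tails g X = {q. degree q = 2 * g - 1 \<and> lead_coeff q = 1 \<and> coeff q (2 * g - 2) = 0 \<and>
     (\<forall>j < 2 * g - 1. \<bar>real_of_int (coeff q j)\<bar> < X ^ (2 * g - 1 - j))}"

lemma height_family_iff:
  assumes "g \<ge> 1" "X > 0"
  shows "f \<in> height_family g X \<longleftrightarrow> degree f = 2 * g + 1 \<and> lead_coeff f = 1 \<and> coeff f (2 * g) = 0 \<and>
    discriminant f \<noteq> 0 \<and> (\<forall>j < 2 * g + 1. \<bar>real_of_int (coeff f j)\<bar> < X ^ (2 * g + 1 - j))"
proof (cases "degree f = 2 * g + 1 \<and> coeff f (2 * g) = 0")
  case True
  have "(\<forall>j. j + 2 \<le> 2 * g + 1 \<longrightarrow> \<bar>real_of_int (coeff f j)\<bar> < X ^ (2 * g + 1 - j)) \<longleftrightarrow>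
    (\<forall>j < 2 * g + 1. \<bar>real_of_int (coeff f j)\<bar> < X ^ (2 * g + 1 - j))"
  proof safe
    fix j assume *: "\<forall>j. j + 2 \<le> 2 * g + 1 \<longrightarrow> \<bar>real_of_int (coeff f j)\<bar> < X ^ (2 * g + 1 - j)" "j < 2 * g + 1"
    show "\<bar>real_of_int (coeff f j)\<bar> < X ^ (2 * g + 1 - j)"
    \<comment> \<open>The uniform range of \<open>j\<close> includes \<open>2 * g\<close>, where the
      coefficient is zero and the bound reads \<open>0 < X\<close>.\<close>
    proof (cases "j = 2 * g")
      case False
      then show ?thesis using * by simp
    qed (use True assms in auto)
  qed auto
  then show ?thesis
    using Ht_less_iff[of f "2 * g + 1" X] assms True by (simp add: height_family_def)
qed (auto simp: height_family_def)

lemma pCons_in_height_family_iff: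
  assumes "g \<ge> 1" "X > 0"
  shows "pCons u (pCons v q) \<in> height_family g X \<longleftrightarrow> q \<in> tails g X \<and>
    \<bar>real_of_int v\<bar> < X ^ (2 * g) \<and> \<bar>real_of_int u\<bar> < X ^ (2 * g + 1) \<and>
    discriminant (pCons u (pCons v q)) \<noteq> 0"
proof (cases "q = 0")
  case True
  then show ?thesis
    using assms by (auto simp: height_family_iff tails_def)
next
  case False
  obtain k where k: "g = Suc k" using assms(1) by (cases g) auto
  have split: "(\<forall>j < 2 * g + 1. P j) \<longleftrightarrow> P 0 \<and> P (Suc 0) \<and> (\<forall>j < 2 * g - 1. P (Suc (Suc j)))" for P
    by (simp add: k All_less_Suc2)
  show ?thesis
    using False unfolding height_family_iff[OF assms] split tails_def by (auto simp: k)
qed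

text \<open>Since \<open>ln Ht\<close> lies between 0 and \<open>ln X\<close>, and
  \<open>weil_height\<close> is the logarithm of the larger of \<open>|a|\<close> and
  \<open>d^2\<close>, both are at most \<open>X^(2g-1)\<close>.\<close>

lemma rational_point_bounds:
  assumes "g \<ge> 1" "X \<ge> 1" "\<epsilon> > 0" "f \<in> height_family g X" "(\<alpha>, \<beta>) \<in> affine_curve_points f"
    and "weil_height \<alpha> \<le> (2 * real g - 1 - \<epsilon>) * ln (Ht (map_poly real_of_int f))"
  obtains a d c where "coprime a d" "d \<ge> 1" "\<bar>real_of_int a\<bar> \<le> X ^ (2 * g - 1)"
    "(real_of_int d)\<^sup>2 \<le> X ^ (2 * g - 1)" "c \<ge> 0" "c\<^sup>2 = hom_eval f a (d\<^sup>2)"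
proof -
  have f: "lead_coeff f = 1" "degree f = 2 * g + 1" "Ht (map_poly real_of_int f) < X"
    using assms(4) by (auto simp: height_family_def)
  from rational_point_on_odd_monic[OF f(1,2) assms(5)] obtain a d c
    where adc: "quotient_of \<alpha> = (a, d\<^sup>2)" "coprime a d" "d \<ge> 1" "c \<ge> 0" "c\<^sup>2 = hom_eval f a (d\<^sup>2)" .
  let ?L = "ln (Ht (map_poly real_of_int f))" and ?m = "real_of_int (max \<bar>a\<bar> \<bar>d\<^sup>2\<bar>)"
  have L: "0 \<le> ?L" "?L \<le> ln X" using ln_Ht_bounds[of f X] f assms by auto
  have "d\<^sup>2 > 0" using adc(3) by simp
  then have m: "?m > 0" by linarith
  have "ln ?m \<le> (2 * real g - 1 - \<epsilon>) * ?L" using assms(6) adc(1) by (simp add: weil_height_def)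
  also have "\<dots> \<le> (2 * real g - 1) * ?L" using assms L by (intro mult_right_mono) auto
  also have "\<dots> \<le> (2 * real g - 1) * ln X" using assms L by (intro mult_left_mono) auto
  also have "\<dots> = ln (X ^ (2 * g - 1))" using assms by (simp add: ln_realpow of_nat_diff)
  finally have "?m \<le> X ^ (2 * g - 1)" using m assms(2) by simp
  then have "\<bar>real_of_int a\<bar> \<le> X ^ (2 * g - 1)" "(real_of_int d)\<^sup>2 \<le> X ^ (2 * g - 1)"
    by (simp_all add: of_int_max)
  then show ?thesis using that[OF adc(2,3) _ _ adc(4,5)] by blast
qed

section \<open>Counting the two lowest coefficients over a fixed point\<close>

text \<open>The roots are compared through the difference of their squares. For
  \<open>a <= 2 X d^2\<close>, that difference bounds \<open>(c' - c)^2\<close>; for larger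
  \<open>a\<close>, the lower bound on \<open>c\<close> allows division by
  \<open>c' + c >= 2 c\<close>.\<close>

lemma root_gap_bound:
  fixes X a d c c' :: real
  assumes "g \<ge> 1" "X \<ge> 1" "a \<ge> 0" "d \<ge> 1" "a \<le> X ^ (2 * g - 1)" "d\<^sup>2 \<le> X ^ (2 * g - 1)"
    and "0 \<le> c" "c \<le> c'"
    and diff: "(c' - c) * (c' + c) \<le> 2 * X ^ (2 * g) * d ^ (4 * g) * (X * d\<^sup>2 + a)"
    and large: "2 * X * d\<^sup>2 \<le> a \<Longrightarrow> a ^ (2 * g + 1) / 2 \<le> c\<^sup>2"
  shows "c' - c \<le> 6 * X ^ (2 * g) * sqrt X * d ^ (4 * g) / (a + 1)"
proof -
  let ?D = "d ^ (4 * g)"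
  obtain k where k: "g = Suc k" using assms(1) by (cases g) auto
  have X: "X > 0" and D: "?D > 0" using assms by auto
  have d2: "d\<^sup>2 \<ge> 1" using assms by simp
  have "(c' - c) * (a + 1) \<le> 6 * X ^ (2 * g) * sqrt X * ?D"
  proof (cases "a \<le> 2 * X * d\<^sup>2")
    case True
    have "(c' - c)\<^sup>2 \<le> (c' - c) * (c' + c)"
      unfolding power2_eq_square using assms by (intro mult_left_mono) auto
    also have "\<dots> \<le> 2 * X ^ (2 * g) * ?D * (3 * X * d\<^sup>2)"
      using diff by (rule order_trans) (use X D True in \<open>intro mult_left_mono, auto\<close>)
    finally have 1: "(c' - c)\<^sup>2 \<le> 6 * X ^ (2 * g) * X * ?D * d\<^sup>2" by (simp add: mult_ac)
    have "1 \<le> X ^ (2 * g - 1)" using assms by simp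
    moreover have "1 \<le> X * d\<^sup>2" using mult_mono[of 1 X 1 "d\<^sup>2"] assms(2) d2 by simp
    \<comment> \<open>One factor \<open>a + 1\<close> is bounded through
      \<open>a <= X^(2g-1)\<close>, the other through \<open>a <= 2 X d^2\<close>; either bound
      alone would be too weak.\<close>
    ultimately have "(a + 1)\<^sup>2 \<le> (2 * X ^ (2 * g - 1)) * (3 * X * d\<^sup>2)"
      unfolding power2_eq_square[of "a + 1"] using True assms(3,5) by (intro mult_mono) auto
    also have "\<dots> = 6 * X ^ (2 * g) * d\<^sup>2" by (simp add: k)
    finally have 2: "(a + 1)\<^sup>2 \<le> 6 * X ^ (2 * g) * d\<^sup>2" .
    have "((c' - c) * (a + 1))\<^sup>2 \<le> (6 * X ^ (2 * g) * X * ?D * d\<^sup>2) * (6 * X ^ (2 * g) * d\<^sup>2)"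
      unfolding power_mult_distrib using 1 2 X D by (intro mult_mono) auto
    also have "\<dots> = 36 * (X ^ (2 * g))\<^sup>2 * X * ?D * d ^ 4"
      by (simp add: power2_eq_square power4_eq_xxxx)
    also have "\<dots> \<le> 36 * (X ^ (2 * g))\<^sup>2 * X * ?D * ?D"
      using assms X D by (intro mult_left_mono power_increasing) auto
    also have "\<dots> = (6 * X ^ (2 * g) * sqrt X * ?D)\<^sup>2"
      using X by (simp add: power_mult_distrib) (simp add: power2_eq_square)
    finally show ?thesis by (rule power2_le_imp_le) (use X D in auto)
  next
    case False
    then have "2 * X * d\<^sup>2 \<ge> 1" using mult_mono[of 1 "2 * X" 1 "d\<^sup>2"] assms(2) d2 by simp
    then have a1: "a \<ge> 1" using False by simp
    have c2: "a ^ (2 * g + 1) \<le> 2 * c\<^sup>2" using large False by simp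
    moreover have "a ^ (2 * g + 1) \<ge> 1" using a1 by (rule one_le_power)
    ultimately have "c\<^sup>2 > 0" by linarith
    then have c: "c > 0" using assms(7) by simp
    \<comment> \<open>Multiplied by \<open>a\<close> and combined with
      \<open>a^(2g+1) <= 2 c^2\<close>, this yields \<open>a^2 <= 2 sqrt X c\<close>. The factor
      \<open>X\<close> is there for \<open>g = 1\<close>, where \<open>a <= X^(2g-1) = X\<close>;
      for larger \<open>g\<close> already \<open>a^3 <= a^(2g)\<close>.\<close>
    have "a ^ 3 \<le> X * a ^ (2 * g)"
    proof (cases "k = 0")
      case True
      then have "a * a\<^sup>2 \<le> X * a\<^sup>2" using assms(5) k by (intro mult_right_mono) auto
      then show ?thesis using True k by (simp add: power3_eq_cube power2_eq_square mult_ac)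
    next
      case False
      then have "a ^ 3 \<le> 1 * a ^ (2 * g)" using a1 k by (simp del: power_Suc, intro power_increasing) auto
      also have "\<dots> \<le> X * a ^ (2 * g)" using assms by (intro mult_right_mono) auto
      finally show ?thesis .
    qed
    then have "a * a ^ 3 \<le> a * (X * a ^ (2 * g))" using assms by (intro mult_left_mono) auto
    also have "\<dots> = X * a ^ (2 * g + 1)" by simp
    also have "\<dots> \<le> X * (2 * c\<^sup>2)" using c2 X by (intro mult_left_mono) auto
    also have "\<dots> \<le> X * (4 * c\<^sup>2)" using X by (intro mult_left_mono) auto
    finally have "(a\<^sup>2)\<^sup>2 \<le> (2 * sqrt X * c)\<^sup>2"
      using X by (simp add: power_mult_distrib) (simp add: power_numeral_reduce)
    then have a2: "a\<^sup>2 \<le> 2 * sqrt X * c" by (rule power2_le_imp_le) (use X c in auto)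
    have "((c' - c) * (a + 1)) * (2 * c) = ((c' - c) * (2 * c)) * (a + 1)" by simp
    also have "\<dots> \<le> ((c' - c) * (c' + c)) * (2 * a)"
      using assms a1 by (intro mult_mono mult_left_mono) auto
    also have "\<dots> \<le> (2 * X ^ (2 * g) * ?D * (3/2 * a)) * (2 * a)"
    proof (intro mult_right_mono)
      show "(c' - c) * (c' + c) \<le> 2 * X ^ (2 * g) * ?D * (3/2 * a)"
        using diff by (rule order_trans) (use X D False in \<open>intro mult_left_mono, auto\<close>)
    qed (use a1 in auto)
    also have "\<dots> = 6 * X ^ (2 * g) * ?D * a\<^sup>2" by (simp add: power2_eq_square)
    also have "\<dots> \<le> 6 * X ^ (2 * g) * ?D * (2 * sqrt X * c)" using a2 X D by (intro mult_left_mono) auto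
    also have "\<dots> = (6 * X ^ (2 * g) * sqrt X * ?D) * (2 * c)" by simp
    finally show ?thesis using c by (simp only: mult_le_cancel_right)
  qed
  then show ?thesis using assms(3) by (simp add: pos_le_divide_eq)
qed

lemma finite_int_abs_less: "finite {u :: int. \<bar>real_of_int u\<bar> < Y}"
proof (rule finite_subset)
  show "{u :: int. \<bar>real_of_int u\<bar> < Y} \<subseteq> {-\<lceil>Y\<rceil>..\<lceil>Y\<rceil>}"
    by (auto simp: abs_less_iff) linarith+
qed simp

text \<open>The square condition is what a rational point over \<open>a / d^2\<close> implies;
  \<open>c >= 0\<close> singles out one root per pair.\<close>

definition fibre :: "nat \<Rightarrow> real \<Rightarrow> int poly \<Rightarrow> int \<Rightarrow> int \<Rightarrow> (int \<times> int) set" where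
  "fibre g X q a d = {(u, v). \<bar>real_of_int u\<bar> < X ^ (2 * g + 1) \<and> \<bar>real_of_int v\<bar> < X ^ (2 * g) \<and>
     (\<exists>c\<ge>0. c\<^sup>2 = hom_eval (pCons u (pCons v q)) a (d\<^sup>2))}"

lemma finite_fibre: "finite (fibre g X q a d)"
  by (rule finite_subset[of _ "{u. \<bar>real_of_int u\<bar> < X ^ (2 * g + 1)} \<times> {v. \<bar>real_of_int v\<bar> < X ^ (2 * g)}"])
    (auto simp: fibre_def finite_int_abs_less)

text \<open>Pairs are counted through their root \<open>r p\<close>. With \<open>T = X^(2g)\<close>,
  at most \<open>56 g d T sqrt X / (|a| + 1)\<close> roots occur, and each belongs to at most
  \<open>3 T / d^2\<close> pairs; the constant is \<open>168 = 56 * 3\<close>.\<close>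

lemma card_fibre_le:
  fixes X :: real
  assumes "g \<ge> 1" "X \<ge> 1" "q \<in> tails g X" "coprime a d" "d \<ge> 1"
    and aX: "\<bar>real_of_int a\<bar> \<le> X ^ (2 * g - 1)" and dX: "(real_of_int d)\<^sup>2 \<le> X ^ (2 * g - 1)"
  shows "real (card (fibre g X q a d)) \<le>
    168 * real g * X ^ (4 * g) * sqrt X / (d * (\<bar>real_of_int a\<bar> + 1))"
proof -
  define F where "F p = hom_eval (pCons (fst p) (pCons (snd p) q)) a (d\<^sup>2)" for p
  define r where "r p = (SOME c :: int. c \<ge> 0 \<and> c\<^sup>2 = F p)" for p
  define A where "A = a\<^sup>2 * hom_eval q a (d\<^sup>2)"
  let ?S = "fibre g X q a d"
  have q: "q \<noteq> 0" "degree q = 2 * g - 1" "lead_coeff q = 1" "coeff q (2 * g - 2) = 0"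
    "\<And>j. j < 2 * g - 1 \<Longrightarrow> \<bar>real_of_int (coeff q j)\<bar> < X ^ (2 * g - 1 - j)"
    using assms(1,3) by (auto simp: tails_def)
  have Suc: "Suc (2 * g - Suc 0) = 2 * g" using assms(1) by simp
  \<comment> \<open>Both coefficients of this affine form are divisible by \<open>d^(4g)\<close>, so
    every root squares to the unit \<open>A\<close> modulo \<open>d^(4g)\<close>.\<close>
  have F: "F p = fst p * d ^ (4 * g + 2) + snd p * a * d ^ (4 * g) + A" for p
  proof -
    have "(d\<^sup>2) ^ (2 * g) = d ^ (4 * g)" by (simp flip: power_mult)
    then show ?thesis
      using q(1,2) Suc by (simp add: F_def A_def hom_eval_pCons power_add algebra_simps power2_eq_square)
  qed
  have S: "\<bar>real_of_int (fst p)\<bar> < X ^ (2 * g + 1)" "\<bar>real_of_int (snd p)\<bar> < X ^ (2 * g)"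
      "r p \<ge> 0" "(r p)\<^sup>2 = F p" if "p \<in> ?S" for p
  proof -
    from that show "\<bar>real_of_int (fst p)\<bar> < X ^ (2 * g + 1)" "\<bar>real_of_int (snd p)\<bar> < X ^ (2 * g)"
      by (auto simp: fibre_def)
    from that have "\<exists>c. c \<ge> 0 \<and> c\<^sup>2 = F p" by (auto simp: fibre_def F_def)
    from someI_ex[OF this] show "r p \<ge> 0" "(r p)\<^sup>2 = F p" by (auto simp: r_def)
  qed
  have d: "real_of_int d \<ge> 1" using assms by simp
  define T where "T = X ^ (2 * g)"
  have T: "T > 0" "X ^ (2 * g - 1) \<le> T"
    using assms(2) by (auto simp: T_def intro!: power_increasing)
  define \<Lambda> where "\<Lambda> = 6 * T * sqrt X * real_of_int d ^ (4 * g) / (\<bar>real_of_int a\<bar> + 1)"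
  have gap: "real_of_int (r p' - r p) \<le> \<Lambda>" if p: "p \<in> ?S" "p' \<in> ?S" "r p \<le> r p'" for p p'
  proof -
    let ?D = "real_of_int d ^ (4 * g)"
    have "real_of_int (r p' - r p) * (real_of_int (r p') + r p) = real_of_int (F p' - F p)"
      unfolding S(4)[OF p(1), symmetric] S(4)[OF p(2), symmetric] by (simp add: power2_eq_square algebra_simps)
    also have "\<dots> = (real_of_int (fst p') - fst p) * (?D * d\<^sup>2) + (real_of_int (snd p') - snd p) * (a * ?D)"
      unfolding F by (simp add: algebra_simps power_add power2_eq_square)
    also have "\<dots> \<le> (2 * (X * T)) * (?D * d\<^sup>2) + (2 * T) * (\<bar>real_of_int a\<bar> * ?D)"
    proof (rule add_mono)
      show "(real_of_int (fst p') - fst p) * (?D * d\<^sup>2) \<le> (2 * (X * T)) * (?D * d\<^sup>2)"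
        using S(1)[OF p(1)] S(1)[OF p(2)] d by (intro mult_right_mono) (auto simp: T_def)
      have "\<bar>(real_of_int (snd p') - snd p) * (a * ?D)\<bar> \<le> (2 * T) * (\<bar>real_of_int a\<bar> * ?D)"
        unfolding abs_mult using S(2)[OF p(1)] S(2)[OF p(2)] d by (intro mult_mono) (auto simp: T_def)
      then show "(real_of_int (snd p') - snd p) * (a * ?D) \<le> (2 * T) * (\<bar>real_of_int a\<bar> * ?D)" by linarith
    qed
    also have "\<dots> = 2 * T * ?D * (X * (real_of_int d)\<^sup>2 + \<bar>real_of_int a\<bar>)" by (simp add: algebra_simps)
    finally have diff: "(real_of_int (r p') - r p) * (real_of_int (r p') + r p) \<le>
      2 * X ^ (2 * g) * ?D * (X * (real_of_int d)\<^sup>2 + \<bar>real_of_int a\<bar>)" by (simp add: T_def)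
    have large: "\<bar>real_of_int a\<bar> ^ (2 * g + 1) / 2 \<le> (real_of_int (r p))\<^sup>2"
      if "2 * X * (real_of_int d)\<^sup>2 \<le> \<bar>real_of_int a\<bar>"
    proof -
      let ?f = "pCons (fst p) (pCons (snd p) q)"
      have deg: "degree ?f = 2 * g + 1" using q(1,2) Suc by simp
      have "\<bar>real_of_int a\<bar> ^ degree ?f / 2 \<le> \<bar>real_of_int (hom_eval ?f a (d\<^sup>2))\<bar>"
      proof (rule abs_hom_eval_ge)
        obtain k where k: "g = Suc k" using assms(1) by (cases g) auto
        show "lead_coeff ?f = 1" using q(1,3) by simp
        show "coeff ?f (degree ?f - 1) = 0" using q(4) deg by (simp add: k)
        fix j assume "j < degree ?f"
        then consider "j = 0" | "j = 1" | i where "j = Suc (Suc i)" "i < 2 * g - 1"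
          using deg by (metis One_nat_def Suc_diff_1 Suc_less_eq less_Suc_eq_0_disj add.commute diff_Suc_1
              plus_1_eq_Suc less_diff_conv not_less_eq Suc)
        then show "\<bar>real_of_int (coeff ?f j)\<bar> \<le> X ^ (degree ?f - j)"
          by cases (use S(1,2)[OF p(1)] q(5) deg in \<open>auto simp: less_imp_le\<close>)
      qed (use q that assms(2) in auto)
      then show ?thesis using S(4)[OF p(1)] unfolding deg F_def[symmetric]
        by (metis abs_of_nonneg of_int_power zero_le_power2)
    qed
    show ?thesis
      using root_gap_bound[OF assms(1,2) _ d aX dX _ _ diff large] S(3)[OF p(1)] p(3)
      by (simp add: \<Lambda>_def T_def)
  qed
  have "\<Lambda> \<ge> 0" using T(1) assms(2) d by (simp add: \<Lambda>_def)
  have "coprime A d"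
  proof -
    have "coprime (hom_eval q a (d\<^sup>2)) (d\<^sup>2)" using q(3) assms(4) by (intro coprime_hom_eval) auto
    then show ?thesis using assms(4) by (simp add: A_def)
  qed
  have "real (card (r ` ?S)) \<le> (4 * real g) * d * (2 * \<Lambda> / d ^ (4 * g) + 1)"
  proof (rule order_trans[OF card_square_roots_mod_le[of d "4 * g" A "r ` ?S" \<Lambda>]])
    show "finite (r ` ?S)" by (simp add: finite_fibre)
    fix c assume "c \<in> r ` ?S"
    then obtain p where p: "p \<in> ?S" "c = r p" by auto
    show "d ^ (4 * g) dvd c\<^sup>2 - A"
      using S(4)[OF p(1)] by (simp add: p(2) F power_add)
    fix c' assume "c' \<in> r ` ?S"
    then obtain p' where p': "p' \<in> ?S" "c' = r p'" by auto
    show "\<bar>real_of_int (c - c')\<bar> \<le> \<Lambda>"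
      using gap[OF p(1) p'(1)] gap[OF p'(1) p(1)] \<open>\<Lambda> \<ge> 0\<close> unfolding p(2) p'(2) by linarith
  qed (use assms \<open>coprime A d\<close> \<open>\<Lambda> \<ge> 0\<close> in auto)
  also have "\<dots> = (4 * real g) * d * (12 * T * sqrt X / (\<bar>real_of_int a\<bar> + 1) + 1)"
    using d by (simp add: \<Lambda>_def)
  \<comment> \<open>Here \<open>14 = 12 + 2\<close>: the trailing 1 is absorbed because
    \<open>|a| + 1 <= 2 T sqrt X\<close>.\<close>
  also have "\<dots> \<le> (4 * real g) * d * (14 * T * sqrt X / (\<bar>real_of_int a\<bar> + 1))"
  proof -
    have "1 \<le> X ^ (2 * g - 1)" "sqrt X \<ge> 1" using assms(2) by auto
    then have "\<bar>real_of_int a\<bar> + 1 \<le> 2 * T * 1" using aX T(2) by linarith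
    also have "\<dots> \<le> 2 * T * sqrt X" using T(1) \<open>sqrt X \<ge> 1\<close> by (intro mult_left_mono) auto
    finally have "1 \<le> 2 * T * sqrt X / (\<bar>real_of_int a\<bar> + 1)" by (simp add: pos_le_divide_eq)
    then have "12 * T * sqrt X / (\<bar>real_of_int a\<bar> + 1) + 1 \<le>
      (12 * T * sqrt X + 2 * T * sqrt X) / (\<bar>real_of_int a\<bar> + 1)"
      by (simp only: add_divide_distrib add_left_mono)
    also have "12 * T * sqrt X + 2 * T * sqrt X = 14 * T * sqrt X" by simp
    finally have "12 * T * sqrt X / (\<bar>real_of_int a\<bar> + 1) + 1 \<le> 14 * T * sqrt X / (\<bar>real_of_int a\<bar> + 1)" .
    then show ?thesis using d by (intro mult_left_mono) auto
  qed
  finally have roots: "real (card (r ` ?S)) \<le> (4 * real g) * d * (14 * T * sqrt X / (\<bar>real_of_int a\<bar> + 1))" .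
  have "real (card ?S) \<le> real (card (r ` ?S)) * (3 * T / d\<^sup>2)"
  proof (rule card_le_mult_fibres[where f = r])
    fix c
    let ?E = "{p \<in> ?S. r p = c}"
    \<comment> \<open>For pairs with the same root the two affine values agree. Hence
      \<open>snd\<close> determines \<open>fst\<close>, and since \<open>a\<close> is coprime to
      \<open>d\<close>, the values of \<open>snd\<close> agree modulo \<open>d^2\<close>.\<close>
    have eq: "(fst p - fst p') * d\<^sup>2 = (snd p' - snd p) * a" if "p \<in> ?E" "p' \<in> ?E" for p p'
    proof -
      have "F p = F p'" using that S(4) by (metis (mono_tags, lifting) mem_Collect_eq)
      then have "d ^ (4 * g) * ((fst p - fst p') * d\<^sup>2) = d ^ (4 * g) * ((snd p' - snd p) * a)"
        unfolding F by (simp add: power_add algebra_simps power2_eq_square)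
      then show ?thesis using assms(5) by simp
    qed
    have inj: "inj_on snd ?E"
    proof (rule inj_onI)
      fix p p' assume p: "p \<in> ?E" "p' \<in> ?E" "snd p = snd p'"
      then have "fst p = fst p'" using eq[OF p(1,2)] assms(5) by simp
      then show "p = p'" using p(3) by (rule prod_eqI)
    qed
    have "real (card (snd ` ?E)) \<le> 2 * T / real_of_int (d\<^sup>2) + 1"
    proof (rule card_spaced_le)
      show "finite (snd ` ?E)" by (simp add: finite_fibre)
      show "1 \<le> d\<^sup>2" using assms(5) by simp
      fix v v' assume "v \<in> snd ` ?E" "v' \<in> snd ` ?E"
      then obtain p p' where p: "p \<in> ?E" "p' \<in> ?E" "v = snd p" "v' = snd p'" by blast
      have "d\<^sup>2 dvd (v - v') * a" using eq[OF p(2,1)] unfolding p(3,4) by (metis dvd_triv_right)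
      moreover have "coprime (d\<^sup>2) a" using assms(4) by (simp add: coprime_commute)
      ultimately show "d\<^sup>2 dvd v - v'" by (simp add: coprime_dvd_mult_left_iff)
      show "\<bar>real_of_int (v - v')\<bar> \<le> 2 * T"
        using S(2)[of p] S(2)[of p'] p by (auto simp: T_def)
    qed (use T in auto)
    \<comment> \<open>The 1 is absorbed because \<open>d^2 <= X^(2g-1) <= T\<close>.\<close>
    also have "\<dots> \<le> 3 * T / d\<^sup>2"
    proof -
      have "1 \<le> T / (real_of_int d)\<^sup>2" using dX T d by (simp add: pos_le_divide_eq)
      then show ?thesis by simp
    qed
    finally show "real (card ?E) \<le> 3 * T / d\<^sup>2" using inj by (simp add: card_image)
  qed (auto simp: finite_fibre)
  also have "\<dots> \<le> ((4 * real g) * d * (14 * T * sqrt X / (\<bar>real_of_int a\<bar> + 1))) * (3 * T / d\<^sup>2)"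
    using roots T d by (intro mult_right_mono) auto
  also have "\<dots> = 168 * real g * (T * T) * sqrt X / (d * (\<bar>real_of_int a\<bar> + 1))"
    using d by (simp add: power2_eq_square) (simp add: mult_ac)
  also have "T * T = X ^ (4 * g)" by (simp add: T_def flip: power_add)
  finally show ?thesis .
qed

section \<open>Lower bound for the size of the family\<close>

lemma finite_tails: "finite (tails g X)"
proof -
  define N where "N = {u :: int. \<bar>real_of_int u\<bar> < Max ((\<lambda>i. \<bar>X\<bar> ^ i) ` {..2 * g}) + 2}"
  have "(\<lambda>q. map (coeff q) [0..<2 * g]) ` tails g X \<subseteq> {xs. set xs \<subseteq> N \<and> length xs = 2 * g}"
  proof clarsimp
    fix q j assume q: "q \<in> tails g X" and j: "j < 2 * g"
    have M: "\<bar>X\<bar> ^ i \<le> Max ((\<lambda>i. \<bar>X\<bar> ^ i) ` {..2 * g})" if "i \<le> 2 * g" for i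
      using that by (intro Max_ge) auto
    show "coeff q j \<in> N"
    proof (cases "j = 2 * g - 1")
      case True
      then have "coeff q j = 1" using q by (auto simp: tails_def)
      then show ?thesis using M[of 0] by (simp add: N_def)
    next
      case False
      then have "\<bar>real_of_int (coeff q j)\<bar> < X ^ (2 * g - 1 - j)" using q j by (simp add: tails_def)
      also have "\<dots> \<le> \<bar>X\<bar> ^ (2 * g - 1 - j)" by (metis abs_ge_self power_abs)
      also have "\<dots> \<le> Max ((\<lambda>i. \<bar>X\<bar> ^ i) ` {..2 * g})" by (rule M) simp
      finally show ?thesis by (simp add: N_def)
    qed
  qed
  moreover have "finite N" unfolding N_def by (rule finite_int_abs_less)
  ultimately have "finite ((\<lambda>q. map (coeff q) [0..<2 * g]) ` tails g X)"
    using finite_lists_length_eq finite_subset by blast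
  moreover have "inj_on (\<lambda>q. map (coeff q) [0..<2 * g]) (tails g X)"
  proof (rule inj_onI, rule poly_eqI)
    fix p q j assume p: "p \<in> tails g X" and q: "q \<in> tails g X"
      and eq: "map (coeff p) [0..<2 * g] = map (coeff q) [0..<2 * g]"
    show "coeff p j = coeff q j"
    proof (cases "j < 2 * g")
      case True
      then show ?thesis using eq by (metis add_0 diff_zero length_upt nth_map nth_upt)
    next
      case False
      then have "degree p < j \<or> degree p = j" "degree p = degree q" "lead_coeff p = lead_coeff q"
        using p q by (auto simp: tails_def)
      then show ?thesis by (metis coeff_eq_0)
    qed
  qed
  ultimately show ?thesis by (rule finite_imageD)
qed

lemma card_int_abs_less_ge:
  fixes Y :: real
  assumes "Y > 0"
  shows "2 * Y - 1 \<le> real (card {u :: int. \<bar>real_of_int u\<bar> < Y})"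
proof -
  have "{u :: int. \<bar>real_of_int u\<bar> < Y} = {1 - \<lceil>Y\<rceil>..\<lceil>Y\<rceil> - 1}"
    by (auto simp: abs_less_iff) linarith+
  moreover have "\<lceil>Y\<rceil> \<ge> 1" using assms by simp
  ultimately have "real (card {u :: int. \<bar>real_of_int u\<bar> < Y}) = 2 * real_of_int \<lceil>Y\<rceil> - 1" by simp
  then show ?thesis by linarith
qed

text \<open>For each tail and each \<open>v\<close>, at most \<open>2 * g\<close> values of
  \<open>u\<close> are lost to a zero discriminant, and
  \<open>2 X^(2g+1) - 1 - 2g >= X^(2g+1)\<close> because \<open>X >= 2g + 1\<close>. There are at
  least \<open>2 X^(2g) - 1 >= X^(2g)\<close> values of \<open>v\<close>.\<close>

lemma card_height_family_ge:
  fixes X :: real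
  assumes "g \<ge> 1" "X \<ge> 2 * g + 1"
  shows "real (card (tails g X)) * X ^ (4 * g + 1) \<le> real (card (height_family g X))"
proof -
  let ?V = "{v :: int. \<bar>real_of_int v\<bar> < X ^ (2 * g)}"
  let ?U = "\<lambda>(q, v). {u :: int. \<bar>real_of_int u\<bar> < X ^ (2 * g + 1)} - {u. discriminant (pCons u (pCons v q)) = 0}"
  let ?P = "Sigma (tails g X \<times> ?V) ?U"
  have X: "X \<ge> 1" "X > 0" using assms by auto
  have fin: "finite (?U p)" for p by (cases p) (simp add: finite_int_abs_less)
  have U: "X ^ (2 * g + 1) \<le> real (card (?U p))" if pV: "p \<in> tails g X \<times> ?V" for p
  proof -
    obtain q v where p: "p = (q, v)" "q \<in> tails g X" using pV by auto
    then have q: "q \<noteq> 0" "lead_coeff q = 1" "degree q = 2 * g - 1"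
      using assms(1) by (auto simp: tails_def)
    let ?Z = "{u. discriminant (pCons u (pCons v q)) = 0}"
    have "lead_coeff (pCons v q) = 1" "degree (pCons v q) = 2 * g"
      using q(1,2) by simp (use q assms(1) in simp)
    then have Z: "finite ?Z" "card ?Z \<le> 2 * g"
      using card_discriminant_eq_0_le[of "pCons v q"] assms(1) by auto
    have "X ^ 1 \<le> X ^ (2 * g + 1)" using X by (intro power_increasing) auto
    then have "X ^ (2 * g + 1) \<le> (2 * X ^ (2 * g + 1) - 1) - 2 * g"
      using assms(2) unfolding power_one_right by linarith
    also have "\<dots> \<le> real (card {u :: int. \<bar>real_of_int u\<bar> < X ^ (2 * g + 1)}) - real (card ?Z)"
      using card_int_abs_less_ge[of "X ^ (2 * g + 1)"] Z(2) X by (intro diff_mono) auto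
    also have "\<dots> \<le> real (card (?U p))"
      using diff_card_le_card_Diff[OF Z(1), of "{u :: int. \<bar>real_of_int u\<bar> < X ^ (2 * g + 1)}"]
      unfolding p(1) by simp
    finally show ?thesis .
  qed
  have "X ^ (2 * g) \<ge> 1" using X by simp
  then have V: "X ^ (2 * g) \<le> real (card ?V)" using card_int_abs_less_ge[of "X ^ (2 * g)"] by linarith
  have "real (card (tails g X)) * X ^ (4 * g + 1) = real (card (tails g X)) * X ^ (2 * g) * X ^ (2 * g + 1)"
    by (simp flip: power_add)
  also have "\<dots> \<le> real (card (tails g X)) * real (card ?V) * X ^ (2 * g + 1)"
    using V X by (intro mult_right_mono mult_left_mono) auto
  also have "\<dots> = (\<Sum>p\<in>tails g X \<times> ?V. X ^ (2 * g + 1))" by (simp add: card_cartesian_product)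
  also have "\<dots> \<le> (\<Sum>p\<in>tails g X \<times> ?V. real (card (?U p)))" by (intro sum_mono U)
  also have "\<dots> = real (card ?P)"
    using fin by (subst card_SigmaI) (auto simp: finite_tails finite_int_abs_less)
  also have "card ?P \<le> card (height_family g X)"
  proof (rule card_inj_on_le[where f = "\<lambda>((q, v), u). pCons u (pCons v q)"])
    show "inj_on (\<lambda>((q, v), u). pCons u (pCons v q)) ?P" by (auto simp: inj_on_def)
    show "(\<lambda>((q, v), u). pCons u (pCons v q)) ` ?P \<subseteq> height_family g X"
      using assms X by (auto simp: pCons_in_height_family_iff)
  qed (rule finite_height_family)
  finally show ?thesis by simp
qed

section \<open>Summation over all points and the limit\<close>

definition small_point_family :: "nat \<Rightarrow> real \<Rightarrow> real \<Rightarrow> int poly set" where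
  "small_point_family g \<epsilon> X = {f \<in> height_family g X.
     \<exists>(\<alpha>, \<beta>) \<in> affine_curve_points f.
       weil_height \<alpha> \<le> (2 * real g - 1 - \<epsilon>) * ln (Ht (map_poly real_of_int f))}"

text \<open>The nonnegative and the nonpositive \<open>a\<close> contribute one harmonic sum each;
  \<open>a = 0\<close> is counted in both.\<close>

lemma sum_inverse_abs_le:
  "(\<Sum>a\<in>{-int n..int n}. 1 / (\<bar>real_of_int a\<bar> + 1)) \<le> 2 * harm (n + 1)"
proof -
  let ?h = "\<lambda>a :: int. 1 / (\<bar>real_of_int a\<bar> + 1)"
  have pos: "(\<Sum>a\<in>int ` {..n}. ?h a) = harm (n + 1)"
    by (subst sum.reindex) (auto simp: harm_altdef lessThan_Suc_atMost inverse_eq_divide add.commute)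
  have neg: "(\<Sum>a\<in>(\<lambda>k. - int k) ` {..n}. ?h a) = harm (n + 1)"
    by (subst sum.reindex) (auto simp: inj_on_def harm_altdef lessThan_Suc_atMost inverse_eq_divide add.commute)
  have "{-int n..int n} \<subseteq> int ` {..n} \<union> (\<lambda>k. - int k) ` {..n}"
  proof
    fix a assume "a \<in> {-int n..int n}"
    then have "nat \<bar>a\<bar> \<le> n" "a = int (nat \<bar>a\<bar>) \<or> a = - int (nat \<bar>a\<bar>)" by auto
    then show "a \<in> int ` {..n} \<union> (\<lambda>k. - int k) ` {..n}" by blast
  qed
  then have "(\<Sum>a\<in>{-int n..int n}. ?h a) \<le> (\<Sum>a\<in>int ` {..n} \<union> (\<lambda>k. - int k) ` {..n}. ?h a)"
    by (intro sum_mono2) auto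
  also have "\<dots> \<le> (\<Sum>a\<in>int ` {..n}. ?h a) + (\<Sum>a\<in>(\<lambda>k. - int k) ` {..n}. ?h a)"
    by (subst sum.union_inter[symmetric]) (auto intro!: sum_nonneg)
  finally show ?thesis unfolding pos neg by simp
qed

text \<open>A union bound over tails, \<open>d\<close> and \<open>a\<close>. The fibre bound depends
  on \<open>d\<close> and \<open>a\<close> through the product of \<open>1 / d\<close> and
  \<open>1 / (|a| + 1)\<close>, so the summation produces two harmonic sums, at most
  \<open>L\<close> and \<open>2 * L\<close>.\<close>

lemma card_small_point_family_le:
  fixes X \<epsilon> :: real
  assumes "g \<ge> 1" "X \<ge> 1" "\<epsilon> > 0"
  defines "L \<equiv> 1 + ln (2 * X ^ (2 * g - 1))"
  shows "real (card (small_point_family g \<epsilon> X)) \<le>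
    real (card (tails g X)) * (336 * real g * X ^ (4 * g) * sqrt X * L\<^sup>2)"
proof -
  define T where "T = X ^ (2 * g - 1)"
  define n where "n = nat \<lfloor>T\<rfloor>"
  have T: "T \<ge> 1" using assms by (simp add: T_def)
  then have n: "n \<ge> 1" "real n \<le> T" by (auto simp: n_def le_nat_floor)
  let ?B = "tails g X \<times> {1..int n} \<times> {-int n..int n}"
  let ?K = "168 * real g * X ^ (4 * g) * sqrt X"
  define I where "I = {p \<in> ?B. case p of (q, d, a) \<Rightarrow> coprime a d \<and> (real_of_int d)\<^sup>2 \<le> T}"
  define \<Phi> where "\<Phi> = (\<lambda>(q, d, a). (\<lambda>(u, v). pCons u (pCons v q)) ` fibre g X q a d)"
  have finB: "finite ?B" by (simp add: finite_tails)
  then have finI: "finite I" by (simp add: I_def)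
  have "small_point_family g \<epsilon> X \<subseteq> (\<Union>p\<in>I. \<Phi> p)"
  proof
    fix f assume f: "f \<in> small_point_family g \<epsilon> X"
    then obtain \<alpha> \<beta> where hf: "f \<in> height_family g X" and
      pt: "(\<alpha>, \<beta>) \<in> affine_curve_points f"
        "weil_height \<alpha> \<le> (2 * real g - 1 - \<epsilon>) * ln (Ht (map_poly real_of_int f))"
      by (auto simp: small_point_family_def)
    obtain a d c where adc: "coprime a d" "d \<ge> 1" "\<bar>real_of_int a\<bar> \<le> T" "(real_of_int d)\<^sup>2 \<le> T"
      "c \<ge> 0" "c\<^sup>2 = hom_eval f a (d\<^sup>2)"
      using rational_point_bounds[OF assms(1-3) hf pt] unfolding T_def by blast
    obtain u v q where fe: "f = pCons u (pCons v q)" by (metis pCons_cases)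
    have uvq: "q \<in> tails g X" "\<bar>real_of_int v\<bar> < X ^ (2 * g)" "\<bar>real_of_int u\<bar> < X ^ (2 * g + 1)"
      using hf assms unfolding fe by (simp_all add: pCons_in_height_family_iff)
    have "real_of_int d \<le> (real_of_int d)\<^sup>2" using adc(2) by (simp add: self_le_power)
    then have "real_of_int d \<le> T" using adc(4) by linarith
    then have "d \<le> \<lfloor>T\<rfloor>" "\<bar>a\<bar> \<le> \<lfloor>T\<rfloor>" using adc(3) by (simp_all add: le_floor_iff)
    then have "(q, d, a) \<in> I" using uvq(1) adc T by (auto simp: I_def n_def)
    moreover have "(u, v) \<in> fibre g X q a d" using uvq adc(5,6) unfolding fe by (auto simp: fibre_def)
    then have "f \<in> \<Phi> (q, d, a)" unfolding fe \<Phi>_def by force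
    ultimately show "f \<in> (\<Union>p\<in>I. \<Phi> p)" by blast
  qed
  then have "card (small_point_family g \<epsilon> X) \<le> card (\<Union>p\<in>I. \<Phi> p)"
    using finI by (intro card_mono) (auto simp: \<Phi>_def finite_fibre)
  also have "\<dots> \<le> (\<Sum>p\<in>I. card (\<Phi> p))" using finI by (rule card_UN_le)
  finally have "real (card (small_point_family g \<epsilon> X)) \<le> (\<Sum>p\<in>I. real (card (\<Phi> p)))"
    by (metis of_nat_le_iff of_nat_sum)
  also have "\<dots> \<le> (\<Sum>p\<in>I. case p of (q, d, a) \<Rightarrow> ?K * (1 / d * (1 / (\<bar>real_of_int a\<bar> + 1))))"
  proof (rule sum_mono, clarify)
    fix q d a assume p: "(q, d, a) \<in> I"
    then have p': "q \<in> tails g X" "coprime a d" "d \<ge> 1" "\<bar>a\<bar> \<le> int n" "(real_of_int d)\<^sup>2 \<le> T"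
      by (auto simp: I_def)
    have "real_of_int \<bar>a\<bar> \<le> real n" using p'(4) by linarith
    then have "\<bar>real_of_int a\<bar> \<le> T" using n(2) by simp
    have "real (card (\<Phi> (q, d, a))) \<le> real (card (fibre g X q a d))"
      unfolding \<Phi>_def by (simp add: card_image_le finite_fibre)
    also have "\<dots> \<le> ?K / (d * (\<bar>real_of_int a\<bar> + 1))"
      using card_fibre_le[OF assms(1,2) p'(1-3)] p'(5) \<open>\<bar>real_of_int a\<bar> \<le> T\<close> by (simp add: T_def)
    finally show "real (card (\<Phi> (q, d, a))) \<le> ?K * (1 / d * (1 / (\<bar>real_of_int a\<bar> + 1)))" by simp
  qed
  \<comment> \<open>Passing from \<open>I\<close> to the whole box adds only nonnegative terms and
    makes the sum factor.\<close>
  also have "\<dots> \<le> (\<Sum>p\<in>?B. case p of (q, d, a) \<Rightarrow> ?K * (1 / d * (1 / (\<bar>real_of_int a\<bar> + 1))))"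
    using finB assms by (intro sum_mono2) (auto simp: I_def)
  also have "\<dots> = real (card (tails g X)) *
      (?K * ((\<Sum>d\<in>{1..int n}. 1 / real_of_int d) * (\<Sum>a\<in>{-int n..int n}. 1 / (\<bar>real_of_int a\<bar> + 1))))"
    by (simp only: sum.cartesian_product[symmetric] sum_constant sum_product) (simp only: sum_distrib_left)
  also have "\<dots> \<le> real (card (tails g X)) * (?K * (L * (2 * L)))"
  proof -
    \<comment> \<open>The factor 2 inside \<open>L\<close> accommodates \<open>harm (n + 1)\<close>,
      since \<open>n + 1 <= 2 T\<close>.\<close>
    have harm: "harm m \<le> L" if "m > 0" "real m \<le> 2 * T" for m
    proof -
      have "harm m \<le> 1 + ln (real m)" using euler_mascheroni_sequence_decreasing[of 1 m] that(1) by (simp add: harm_def)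
      also have "\<dots> \<le> L" using that by (simp add: L_def T_def)
      finally show ?thesis .
    qed
    have "(\<Sum>d\<in>{1..int n}. 1 / real_of_int d) = harm n"
      unfolding harm_def image_int_atLeastAtMost[of 1 n, simplified, symmetric]
      by (subst sum.reindex) (auto simp: inverse_eq_divide)
    also have "\<dots> \<le> L" using harm[of n] n by simp
    finally have 1: "(\<Sum>d\<in>{1..int n}. 1 / real_of_int d) \<le> L" .
    have "harm (n + 1) \<le> L" using harm[of "n + 1"] n T by simp
    then have 2: "(\<Sum>a\<in>{-int n..int n}. 1 / (\<bar>real_of_int a\<bar> + 1)) \<le> 2 * L"
      using sum_inverse_abs_le[of n] by simp
    have "L \<ge> 0" using harm[of n] n harm_nonneg[of n, where 'a = real] by simp
    then show ?thesis using 1 2 assms(1,2)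
      by (intro mult_left_mono mult_mono) (auto intro!: sum_nonneg)
  qed
  also have "?K * (L * (2 * L)) = 336 * real g * X ^ (4 * g) * sqrt X * L\<^sup>2" by (simp add: power2_eq_square)
  finally show ?thesis .
qed

text \<open>The number of tails cancels between the upper and the lower bound, leaving a squared
  logarithm over \<open>sqrt X\<close>.\<close>

lemma small_point_ratio_tendsto_0:
  assumes "g \<ge> 1" "\<epsilon> > 0"
  shows "((\<lambda>X. real (card (small_point_family g \<epsilon> X)) / real (card (height_family g X))) \<longlongrightarrow> 0) at_top"
proof (rule tendsto_sandwich[OF _ _ tendsto_const])
  define m where "m = 2 * real g - 1"
  have "m > 0" using assms by (simp add: m_def)
  let ?b = "\<lambda>X :: real. 336 * real g * (1 + ln 2 + m * ln X)\<^sup>2 / sqrt X"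
  show "(?b \<longlongrightarrow> 0) at_top" using \<open>m > 0\<close> by real_asymp
  show "eventually (\<lambda>X. real (card (small_point_family g \<epsilon> X)) / real (card (height_family g X)) \<le> ?b X) at_top"
    using eventually_ge_at_top[of "real (2 * g + 1)"]
  proof eventually_elim
    case (elim X)
    then have X: "X \<ge> 1" "X > 0" by auto
    let ?F = "real (card (height_family g X))" and ?Q = "real (card (tails g X))"
    have L: "1 + ln (2 * X ^ (2 * g - 1)) = 1 + ln 2 + m * ln X"
      using X assms by (simp add: ln_mult ln_realpow m_def of_nat_diff)
    have "real (card (small_point_family g \<epsilon> X)) \<le>
        ?Q * (336 * real g * X ^ (4 * g) * sqrt X * (1 + ln 2 + m * ln X)\<^sup>2)"
      using card_small_point_family_le[OF assms(1) X(1) assms(2)] by (simp only: L)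
    also have "\<dots> = (?Q * X ^ (4 * g + 1)) * ?b X"
      using X by (simp add: field_simps)
    also have "\<dots> \<le> ?F * ?b X"
      using card_height_family_ge[of g X] assms elim X by (intro mult_right_mono) auto
    finally have "real (card (small_point_family g \<epsilon> X)) \<le> ?F * ?b X" .
    moreover have "?b X \<ge> 0" using X by simp
    \<comment> \<open>In the case \<open>?F = 0\<close> the quotient is 0 by the convention for
      division by zero, so \<open>?b X >= 0\<close> is enough.\<close>
    ultimately show ?case by (cases "?F = 0") (simp_all add: divide_le_eq mult.commute)
  qed
qed (auto intro!: always_eventually)

theorem theorem1p2:
  fixes g :: nat and \<epsilon> :: real
  assumes "g \<ge> 1" and "\<epsilon> > 0"
  shows "((\<lambda>X::real.
      real (card {f \<in> height_family g X.
        \<exists>(\<alpha>, \<beta>) \<in> affine_curve_points f.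
          weil_height \<alpha> \<le> (2 * real g - 1 - \<epsilon>) * ln (Ht (map_poly real_of_int f))})
      / real (card (height_family g X))) \<longlongrightarrow> 0) at_top"
  using small_point_ratio_tendsto_0[OF assms] unfolding small_point_family_def .

end
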